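(* Let $\phi>0$ be fixed, let $\epsilon>0$, let $M$ be a positive integer and let $\theta$ be a threshold parameter. When allocated $\left\lceil \frac{1+\phi}{\epsilon}\right\rceil$ counters, the algorithm FAST$(M,\epsilon,\phi)$, by returning the set $\{x\in\mathcal U\mid \widehat{v_x}\ge N\cdot M\cdot\theta\}$, solves the $(\theta,\epsilon,M)$-Weighted Heavy Hitters problem. That is, after any $(\mathcal U,M)$-weighted stream of length $N$, with $\widehat{v_x}$ the value returned by Query$(x)$, the set $H=\{x\in\mathcal U\mid \widehat{v_x}\ge N\cdot M\cdot\theta\}$ satisfies, for every $x\in\mathcal U$, $$\bigl(v_x>N\cdot M\cdot\theta\implies x\in H\bigr)\ \wedge\ \bigl(v_x<N\cdot M\cdot(\theta-\epsilon)\implies x\notin H\bigr).$$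
   Context: Streams. Given a set $\mathcal U$ (the universe of ids) and a positive integer $M$, a $(\mathcal U,M)$-weighted stream of length $N$ is a sequence $\langle p_1,\dots,p_N\rangle$ with $p_i=(d_i,w_i)\in\mathcal U\times\{1,\dots,M\}$; $d_i$ is the id and $w_i$ the weight. The volume of $x\in\mathcal U$ is $v_x=\sum_{i:\,d_i=x}w_i$. Processing the stream means calling Add$(d_i,w_i)$ for $i=1,\dots,N$ in order. Algorithm FAST$(M,\epsilon,\phi)$. Let $s=\lfloor M\phi/2+1\rfloor$ and $\mathfrak C=\lceil (1+\phi)/\epsilon\rceil$. The state is a set $C\subseteq\mathcal U$ of items with allocated counters and non-negative integers $c_x,r_x$ for $x\in\mathcal U$. Initially $C=\emptyset$ and $c_x=r_x=0$ for all $x$. Add$(x,w)$: if $x\in C$ or $|C|<\mathfrak C$, then set $c_x\gets c_x+\lfloor (r_x+w)/s\rfloor$ and $r_x\gets (r_x+w)\bmod s$ (both right-hand sides using the old $r_x$), and $C\gets C\cup\{x\}$. Otherwise, choose an arbitrary $m\in\arg\min_{y\in C}c_y$, set $c_x\gets c_m+\lfloor (s-1+w)/s\rfloor$, $r_x\gets (s-1+w)\bmod s$, and $C\gets (C\setminus\{m\})\cup\{x\}$. Query$(x)$: if $x\in C$ or $|C|<\mathfrak C$, return $r_x+s\cdot c_x$; otherwise return $s-1+s\cdot\min_{y\in C}c_y$. *)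

theory Defs
  imports Complex_Main
begin

definition weighted_stream :: "'a set \<Rightarrow> nat \<Rightarrow> ('a \<times> nat) list \<Rightarrow> bool" where
  "weighted_stream U M ps \<longleftrightarrow> set ps \<subseteq> U \<times> {1..M}"

definition volume :: "('a \<times> nat) list \<Rightarrow> 'a \<Rightarrow> nat" where
  "volume ps x = (\<Sum>i | i < length ps \<and> fst (ps ! i) = x. snd (ps ! i))"

definition heavy_hitters_solution ::
  "'a set \<Rightarrow> nat \<Rightarrow> real \<Rightarrow> real \<Rightarrow> ('a \<times> nat) list \<Rightarrow> 'a set \<Rightarrow> bool" where
  "heavy_hitters_solution U M \<theta> \<epsilon> ps H \<longleftrightarrow>
     (\<forall>x\<in>U.
        (real (volume ps x) > real (length ps) * real M * \<theta> \<longrightarrow> x \<in> H) \<and>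
        (real (volume ps x) < real (length ps) * real M * (\<theta> - \<epsilon>) \<longrightarrow> x \<notin> H))"

text \<open>
  A possibly nondeterministic algorithm is the relation between input streams and possible
  outputs.  It solves the problem if on every stream it has an output and each of its possible
  outputs is correct; the first conjunct excludes relations without any run.
\<close>

definition solves_weighted_heavy_hitters ::
  "'a set \<Rightarrow> nat \<Rightarrow> real \<Rightarrow> real \<Rightarrow> (('a \<times> nat) list \<Rightarrow> 'a set \<Rightarrow> bool) \<Rightarrow> bool" where
  "solves_weighted_heavy_hitters U M \<theta> \<epsilon> A \<longleftrightarrow>
     (\<forall>ps. weighted_stream U M ps \<longrightarrow>
        (\<exists>H. A ps H) \<and> (\<forall>H. A ps H \<longrightarrow> heavy_hitters_solution U M \<theta> \<epsilon> ps H))"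

definition step_size :: "nat \<Rightarrow> real \<Rightarrow> nat" where
  "step_size M \<phi> = nat \<lfloor>real M * \<phi> / 2 + 1\<rfloor>"

definition num_counters :: "real \<Rightarrow> real \<Rightarrow> nat" where
  "num_counters \<epsilon> \<phi> = nat \<lceil>(1 + \<phi>) / \<epsilon>\<rceil>"

record 'a fast_state =
  tracked :: "'a set"
  cnt :: "'a \<Rightarrow> nat"
  rmd :: "'a \<Rightarrow> nat"

definition fast_init :: "'a fast_state" where
  "fast_init = \<lparr>tracked = {}, cnt = (\<lambda>_. 0), rmd = (\<lambda>_. 0)\<rparr>"

text \<open>
  The choice of the evicted item is arbitrary among the minimisers, hence a relation.  The values
  \<open>cnt m\<close> and \<open>rmd m\<close> of an evicted item are left unchanged.  For \<open>\<phi> > 0\<close> the step size is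
  positive, so the subtraction \<open>step_size M \<phi> - 1\<close> does not truncate.
\<close>

inductive fast_add ::
  "nat \<Rightarrow> real \<Rightarrow> real \<Rightarrow> 'a fast_state \<Rightarrow> 'a \<times> nat \<Rightarrow> 'a fast_state \<Rightarrow> bool"
  for M :: nat and \<epsilon> \<phi> :: real where
  update:
    "x \<in> tracked \<sigma> \<or> card (tracked \<sigma>) < num_counters \<epsilon> \<phi> \<Longrightarrow>
     fast_add M \<epsilon> \<phi> \<sigma> (x, w)
       \<lparr>tracked = insert x (tracked \<sigma>),
        cnt = (cnt \<sigma>)(x := cnt \<sigma> x + (rmd \<sigma> x + w) div step_size M \<phi>),
        rmd = (rmd \<sigma>)(x := (rmd \<sigma> x + w) mod step_size M \<phi>)\<rparr>"
| replace:
    "x \<notin> tracked \<sigma> \<Longrightarrow> \<not> card (tracked \<sigma>) < num_counters \<epsilon> \<phi> \<Longrightarrow>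
     is_arg_min (cnt \<sigma>) (\<lambda>y. y \<in> tracked \<sigma>) m \<Longrightarrow>
     fast_add M \<epsilon> \<phi> \<sigma> (x, w)
       \<lparr>tracked = insert x (tracked \<sigma> - {m}),
        cnt = (cnt \<sigma>)(x := cnt \<sigma> m + (step_size M \<phi> - 1 + w) div step_size M \<phi>),
        rmd = (rmd \<sigma>)(x := (step_size M \<phi> - 1 + w) mod step_size M \<phi>)\<rparr>"

inductive fast_run ::
  "nat \<Rightarrow> real \<Rightarrow> real \<Rightarrow> ('a \<times> nat) list \<Rightarrow> 'a fast_state \<Rightarrow> bool"
  for M :: nat and \<epsilon> \<phi> :: real where
  start: "fast_run M \<epsilon> \<phi> [] fast_init"
| step: "fast_run M \<epsilon> \<phi> ps \<sigma> \<Longrightarrow> fast_add M \<epsilon> \<phi> \<sigma> p \<sigma>' \<Longrightarrow> fast_run M \<epsilon> \<phi> (ps @ [p]) \<sigma>'"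

definition fast_query :: "nat \<Rightarrow> real \<Rightarrow> real \<Rightarrow> 'a fast_state \<Rightarrow> 'a \<Rightarrow> nat" where
  "fast_query M \<epsilon> \<phi> \<sigma> x =
     (if x \<in> tracked \<sigma> \<or> card (tracked \<sigma>) < num_counters \<epsilon> \<phi>
      then rmd \<sigma> x + step_size M \<phi> * cnt \<sigma> x
      else step_size M \<phi> - 1 + step_size M \<phi> * Min (cnt \<sigma> ` tracked \<sigma>))"

definition fast_heavy_hitters ::
  "'a set \<Rightarrow> nat \<Rightarrow> real \<Rightarrow> real \<Rightarrow> real \<Rightarrow> ('a \<times> nat) list \<Rightarrow> 'a set \<Rightarrow> bool" where
  "fast_heavy_hitters U M \<epsilon> \<phi> \<theta> ps H \<longleftrightarrow>
     (\<exists>\<sigma>. fast_run M \<epsilon> \<phi> ps \<sigma> \<and>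
        H = {x \<in> U. real (fast_query M \<epsilon> \<phi> \<sigma> x) \<ge> real (length ps) * real M * \<theta>})"

end

theory Submission
  imports Defs
begin

text \<open>
  As in the Space Saving algorithm, the estimate of an item lies between its volume and its volume
  plus \<open>s - 1 + s * c\<close>, where \<open>s\<close> is the step size and \<open>c\<close> is the minimal counter: estimates are exact
  until all counters are allocated, and from then on \<open>c\<close> never decreases.  Each arrival increases the sum of the tracked estimates by at most
  \<open>M + s - 1 \<le> M * (1 + \<phi> / 2)\<close>, so \<open>K = num_counters \<epsilon> \<phi>\<close> counters give
  \<open>s * c \<le> N * M * (1 + \<phi> / 2) / K\<close>.  Moreover \<open>N \<ge> K \<ge> (1 + \<phi>) / \<epsilon>\<close> when the counters are
  exhausted, so the rounding error \<open>s - 1 \<le> M * \<phi> / 2\<close> is absorbed in the remaining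
  \<open>N * M * (\<phi> / 2) / K\<close>.
\<close>

section \<open>Estimates and volumes\<close>

definition estimate :: "nat \<Rightarrow> 'a fast_state \<Rightarrow> 'a \<Rightarrow> nat" where
  "estimate s \<sigma> x = rmd \<sigma> x + s * cnt \<sigma> x"

text \<open>Quotient and remainder recombine to \<open>q\<close>, so both branches of Add act on
  estimates by plain addition; \<open>k\<close> is the item's own old counter or that of the evicted
  item.\<close>

lemma estimate_upd:
  "estimate s \<lparr>tracked = C, cnt = c(x := k + q div s), rmd = r(x := q mod s)\<rparr> y =
     (if y = x then q + s * k else r y + s * c y)"
  by (simp add: estimate_def algebra_simps)

lemma volume_Nil [simp]: "volume [] x = 0"
  by (simp add: volume_def)

lemma volume_snoc:
  "volume (ps @ [(y, w)]) x = volume ps x + (if x = y then w else 0)"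
proof -
  have *: "volume qs x = (\<Sum>i<length qs. if fst (qs ! i) = x then snd (qs ! i) else 0)"
    for qs :: "('a \<times> nat) list"
    unfolding volume_def by (simp add: sum.If_cases Collect_conj_eq lessThan_def)
  have "(\<Sum>i<length ps. if fst ((ps @ [(y, w)]) ! i) = x then snd ((ps @ [(y, w)]) ! i) else 0)
      = (\<Sum>i<length ps. if fst (ps ! i) = x then snd (ps ! i) else 0)"
    by (rule sum.cong) (auto simp: nth_append)
  then show ?thesis
    by (auto simp: *)
qed

section \<open>The invariant and its preservation\<close>

text \<open>Quantifying over every tracked \<open>y\<close> expresses bounds by the minimal counter
  without a \<open>Min\<close> over a possibly empty set. Once the counters are full, estimates of
  untracked items may be stale and are left unconstrained; only their volumes are bounded.\<close>

definition fast_invariant ::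
  "nat \<Rightarrow> nat \<Rightarrow> nat \<Rightarrow> ('a \<times> nat) list \<Rightarrow> 'a fast_state \<Rightarrow> bool" where
  "fast_invariant M s K ps \<sigma> \<longleftrightarrow>
     finite (tracked \<sigma>) \<and> card (tracked \<sigma>) \<le> K \<and> card (tracked \<sigma>) \<le> length ps \<and>
     (\<forall>x. rmd \<sigma> x < s) \<and>
     (\<Sum>x\<in>tracked \<sigma>. estimate s \<sigma> x) \<le> length ps * (M + (s - 1)) \<and>
     (\<forall>x\<in>tracked \<sigma>. volume ps x \<le> estimate s \<sigma> x) \<and>
     (\<forall>x\<in>tracked \<sigma>. \<forall>y\<in>tracked \<sigma>.
        estimate s \<sigma> x \<le> volume ps x + (s - 1 + s * cnt \<sigma> y)) \<and>
     (\<forall>x. x \<notin> tracked \<sigma> \<longrightarrow> (\<forall>y\<in>tracked \<sigma>. volume ps x \<le> s - 1 + s * cnt \<sigma> y)) \<and>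
     (card (tracked \<sigma>) < K \<longrightarrow>
        (\<forall>x. estimate s \<sigma> x = volume ps x \<and> (x \<notin> tracked \<sigma> \<longrightarrow> volume ps x = 0)))"

lemma fast_invariant_init: "0 < s \<Longrightarrow> fast_invariant M s K [] fast_init"
  by (simp add: fast_invariant_def fast_init_def estimate_def)

text \<open>An update changes estimate and volume of the item by the same weight, and counters only
  grow. In a replacement the newcomer starts from \<open>s - 1 + s * cnt \<sigma> m\<close>, which
  by the invariant bounds its earlier volume.\<close>

lemma fast_invariant_add:
  assumes inv: "fast_invariant M (step_size M \<phi>) (num_counters \<epsilon> \<phi>) ps \<sigma>"
    and add: "fast_add M \<epsilon> \<phi> \<sigma> p \<sigma>'" and w: "snd p \<le> M" and s: "0 < step_size M \<phi>"
  shows "fast_invariant M (step_size M \<phi>) (num_counters \<epsilon> \<phi>) (ps @ [p]) \<sigma>'"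
proof -
  define s K C where "s = step_size M \<phi>" and "K = num_counters \<epsilon> \<phi>" and "C = tracked \<sigma>"
  note defs = s_def [symmetric] K_def [symmetric] C_def [symmetric]
  note I = inv [unfolded fast_invariant_def defs]
  have fin: "finite C" and cardK: "card C \<le> K" and cardN: "card C \<le> length ps"
    and rs: "\<And>x. rmd \<sigma> x < s"
    and total: "(\<Sum>x\<in>C. estimate s \<sigma> x) \<le> length ps * (M + (s - 1))"
    and lower: "\<And>x. x \<in> C \<Longrightarrow> volume ps x \<le> estimate s \<sigma> x"
    and upper: "\<And>x y. x \<in> C \<Longrightarrow> y \<in> C \<Longrightarrow>
      estimate s \<sigma> x \<le> volume ps x + (s - 1 + s * cnt \<sigma> y)"
    and untracked: "\<And>x y. x \<notin> C \<Longrightarrow> y \<in> C \<Longrightarrow> volume ps x \<le> s - 1 + s * cnt \<sigma> y"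
    and exact: "\<And>x. card C < K \<Longrightarrow> estimate s \<sigma> x = volume ps x"
    and zero: "\<And>x. card C < K \<Longrightarrow> x \<notin> C \<Longrightarrow> volume ps x = 0"
    using I by blast+
  have s0: "0 < s" using s by (simp add: s_def)
  from add show ?thesis
  proof cases
    case (update x w)
    let ?c = "(cnt \<sigma>)(x := cnt \<sigma> x + (rmd \<sigma> x + w) div s)"
    have wM: "w \<le> M" using w update by simp
    have \<sigma>': "tracked \<sigma>' = insert x C" "cnt \<sigma>' = ?c" "\<And>y. rmd \<sigma>' y < s"
      using update rs s0 by (auto simp: defs)
    have est: "estimate s \<sigma>' y = estimate s \<sigma> y + (if y = x then w else 0)" for y
      using update by (simp add: defs estimate_upd) (simp add: estimate_def)
    have cnt_mono: "s * cnt \<sigma> y \<le> s * cnt \<sigma>' y" for y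
      by (simp add: \<sigma>')
    have vol: "volume (ps @ [p]) y = volume ps y + (if y = x then w else 0)" for y
      using update by (simp add: volume_snoc)
    show ?thesis
    proof (cases "x \<in> C")
      case True
      then have C': "tracked \<sigma>' = C" by (auto simp: \<sigma>')
      have total': "(\<Sum>y\<in>C. estimate s \<sigma>' y) \<le> length (ps @ [p]) * (M + (s - 1))"
        using total True fin wM by (simp add: est sum.distrib)
      have upper': "estimate s \<sigma> y \<le> volume ps y + (s - 1 + s * cnt \<sigma>' z)"
        if "y \<in> C" "z \<in> C" for y z
        using upper [OF that] cnt_mono [of z] by linarith
      have untracked': "volume ps y \<le> s - 1 + s * cnt \<sigma>' z" if "y \<notin> C" "z \<in> C" for y z
        using untracked [OF that] cnt_mono [of z] by linarith
      show ?thesis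
        unfolding fast_invariant_def defs C' est vol
        using fin cardK cardN \<sigma>'(3) total' lower upper' untracked' exact zero True
        by (auto simp: est)
    next
      case False
      then have less: "card C < K" using update by (simp add: defs)
      \<comment> \<open>Exactness persists even if this step fills the last counter, so all bounds
        on tracked items are immediate.\<close>
      have estC: "estimate s \<sigma>' y = volume (ps @ [p]) y" for y
        by (simp add: est vol exact [OF less])
      have "(\<Sum>y\<in>C. estimate s \<sigma>' y) = (\<Sum>y\<in>C. estimate s \<sigma> y)"
        using False by (intro sum.cong) (auto simp: est)
      then have total': "(\<Sum>y\<in>insert x C. estimate s \<sigma>' y) \<le> length (ps @ [p]) * (M + (s - 1))"
        using total wM False fin zero [OF less False] exact [OF less, of x] by (simp add: est)
      have zero': "volume (ps @ [p]) y = 0" if "y \<notin> insert x C" for y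
        using that zero [OF less, of y] by (simp add: vol)
      show ?thesis
        unfolding fast_invariant_def defs \<sigma>'(1)
        using fin less cardN \<sigma>'(3) total' zero' False by (auto simp: estC)
    qed
  next
    case (replace x m w)
    let ?e = "s - 1 + w + s * cnt \<sigma> m"
    let ?c = "(cnt \<sigma>)(x := cnt \<sigma> m + (s - 1 + w) div s)"
    have wM: "w \<le> M" using w replace by simp
    have xC: "x \<notin> C" and full: "\<not> card C < K" using replace by (auto simp: defs)
    have mC: "m \<in> C" and m_min: "\<And>y. y \<in> C \<Longrightarrow> cnt \<sigma> m \<le> cnt \<sigma> y"
      using replace by (auto simp: defs is_arg_min_linorder)
    have \<sigma>': "tracked \<sigma>' = insert x (C - {m})" "cnt \<sigma>' = ?c" "\<And>y. rmd \<sigma>' y < s"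
      using replace rs s0 by (auto simp: defs)
    have est: "estimate s \<sigma>' y = (if y = x then ?e else estimate s \<sigma> y)" for y
      using replace by (simp add: defs estimate_upd) (simp add: estimate_def)
    \<comment> \<open>The minimal counter does not decrease, so it suffices to prove the new upper
      bounds with the old counter of \<open>m\<close>.\<close>
    have cnt_ge: "s * cnt \<sigma> m \<le> s * cnt \<sigma>' y" if "y \<in> insert x C" for y
      using that m_min xC by (auto simp: \<sigma>')
    have vol: "volume (ps @ [p]) y = volume ps y + (if y = x then w else 0)" for y
      using replace by (simp add: volume_snoc)
    have card': "card (insert x (C - {m})) = card C"
      using fin mC xC by (metis card.remove card_insert_disjoint finite_Diff Diff_iff)
    have "(\<Sum>y\<in>C - {m}. estimate s \<sigma>' y) = (\<Sum>y\<in>C - {m}. estimate s \<sigma> y)"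
      using xC by (intro sum.cong) (auto simp: est)
    moreover have "(\<Sum>y\<in>C. estimate s \<sigma> y) = estimate s \<sigma> m + (\<Sum>y\<in>C - {m}. estimate s \<sigma> y)"
      by (rule sum.remove [OF fin mC])
    \<comment> \<open>The departing estimate is at least \<open>s * cnt \<sigma> m\<close>, so the
      sum grows by at most \<open>s - 1 + w\<close>.\<close>
    ultimately have total':
      "(\<Sum>y\<in>insert x (C - {m}). estimate s \<sigma>' y) \<le> length (ps @ [p]) * (M + (s - 1))"
      using total wM fin xC by (simp add: est) (simp add: estimate_def)
    have lower': "volume (ps @ [p]) y \<le> estimate s \<sigma>' y" if "y \<in> insert x (C - {m})" for y
      using that lower [of y] untracked [OF xC mC] by (auto simp: est vol)
    have upper': "estimate s \<sigma>' y \<le> volume (ps @ [p]) y + (s - 1 + s * cnt \<sigma>' z)"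
      if "y \<in> insert x (C - {m})" "z \<in> insert x (C - {m})" for y z
    proof -
      have z: "s * cnt \<sigma> m \<le> s * cnt \<sigma>' z" using that by (intro cnt_ge) auto
      show ?thesis
      proof (cases "y = x")
        case True
        have "estimate s \<sigma>' y = ?e" by (simp add: est True)
        moreover have "volume (ps @ [p]) y = volume ps x + w" by (simp add: vol True)
        ultimately show ?thesis using z by linarith
      next
        case False
        then have "y \<in> C" using that(1) by auto
        have "estimate s \<sigma>' y = estimate s \<sigma> y" using False by (simp add: est)
        moreover have "volume (ps @ [p]) y = volume ps y" using False by (simp add: vol)
        ultimately show ?thesis using z upper [OF \<open>y \<in> C\<close> mC] by linarith
      qed
    qed
    have untracked': "volume (ps @ [p]) y \<le> s - 1 + s * cnt \<sigma>' z"
      if "y \<notin> insert x (C - {m})" "z \<in> insert x (C - {m})" for y z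
    proof -
      have "s * cnt \<sigma> m \<le> s * cnt \<sigma>' z" using that by (intro cnt_ge) auto
      moreover have "volume ps y \<le> s - 1 + s * cnt \<sigma> m"
      \<comment> \<open>The evicted item is newly untracked. Its volume is at most its last
        estimate, whose remainder is at most \<open>s - 1\<close>; this is why remainders are
        bounded in the invariant.\<close>
      proof (cases "y = m")
        case True
        have "rmd \<sigma> m \<le> s - 1" using rs [of m] by linarith
        with lower [OF mC] show ?thesis unfolding True estimate_def by linarith
      qed (use that untracked [of y m] mC in auto)
      moreover have "volume (ps @ [p]) y = volume ps y" using that(1) by (simp add: vol)
      ultimately show ?thesis by linarith
    qed
    show ?thesis
      unfolding fast_invariant_def defs \<sigma>'(1) card'
      using fin cardK cardN full \<sigma>'(3) total' lower' upper' untracked' by auto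
  qed
qed

lemma fast_run_invariant:
  assumes "fast_run M \<epsilon> \<phi> ps \<sigma>" and "\<forall>p\<in>set ps. snd p \<le> M" and "0 < step_size M \<phi>"
  shows "fast_invariant M (step_size M \<phi>) (num_counters \<epsilon> \<phi>) ps \<sigma>"
  using assms
proof induction
  case start
  then show ?case by (simp add: fast_invariant_init)
next
  case (step ps \<sigma> p \<sigma>')
  then show ?case by (intro fast_invariant_add [OF _ step.hyps(2)]) auto
qed

section \<open>Existence of runs\<close>

text \<open>With a positive number of counters, a full set of tracked items is nonempty, and being
  finite it has a minimiser to evict.\<close>

lemma fast_add_total:
  assumes "finite (tracked \<sigma>)" and "0 < num_counters \<epsilon> \<phi>"
  shows "\<exists>\<sigma>'. fast_add M \<epsilon> \<phi> \<sigma> p \<sigma>'"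
proof (cases p)
  case (Pair x w)
  show ?thesis
  proof (cases "x \<in> tracked \<sigma> \<or> card (tracked \<sigma>) < num_counters \<epsilon> \<phi>")
    case True
    then show ?thesis unfolding Pair by (intro exI) (rule fast_add.update)
  next
    case False
    then have "tracked \<sigma> \<noteq> {}" using assms by auto
    then obtain m where "is_arg_min (cnt \<sigma>) (\<lambda>y. y \<in> tracked \<sigma>) m"
      using ex_is_arg_min_if_finite assms(1) by blast
    with False show ?thesis unfolding Pair by (intro exI) (rule fast_add.replace, auto)
  qed
qed

text \<open>Gives the existence half of \<open>solves_weighted_heavy_hitters\<close>; the invariant
  supplies the finiteness needed to extend a run.\<close>

lemma fast_run_total:
  assumes "0 < num_counters \<epsilon> \<phi>" and "\<forall>p\<in>set ps. snd p \<le> M" and "0 < step_size M \<phi>"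
  shows "\<exists>\<sigma>. fast_run M \<epsilon> \<phi> ps \<sigma>"
  using assms(2)
proof (induction ps rule: rev_induct)
  case Nil
  show ?case by (blast intro: fast_run.start)
next
  case (snoc p ps)
  then obtain \<sigma> where run: "fast_run M \<epsilon> \<phi> ps \<sigma>" by auto
  have "fast_invariant M (step_size M \<phi>) (num_counters \<epsilon> \<phi>) ps \<sigma>"
    using fast_run_invariant [OF run _ assms(3)] snoc.prems by simp
  then have "finite (tracked \<sigma>)" by (simp add: fast_invariant_def)
  then obtain \<sigma>' where "fast_add M \<epsilon> \<phi> \<sigma> p \<sigma>'"
    using fast_add_total assms(1) by blast
  with run show ?case by (blast intro: fast_run.step)
qed

section \<open>Error bounds for queries\<close>

lemma fast_query_bounds:
  assumes inv: "fast_invariant M (step_size M \<phi>) (num_counters \<epsilon> \<phi>) ps \<sigma>"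
    and \<phi>: "\<phi> > 0" and \<epsilon>: "\<epsilon> > 0"
  shows "volume ps x \<le> fast_query M \<epsilon> \<phi> \<sigma> x"
    and "real (fast_query M \<epsilon> \<phi> \<sigma> x) \<le> real (volume ps x) + real (length ps) * real M * \<epsilon>"
proof -
  define s K C where "s = step_size M \<phi>" and "K = num_counters \<epsilon> \<phi>" and "C = tracked \<sigma>"
  note defs = s_def [symmetric] K_def [symmetric] C_def [symmetric]
  note I = inv [unfolded fast_invariant_def defs]
  let ?Q = "fast_query M \<epsilon> \<phi> \<sigma> x" and ?V = "volume ps x" and ?N = "length ps"
  have K: "(1 + \<phi>) / \<epsilon> \<le> real K"
    unfolding K_def num_counters_def by linarith
  with \<phi> \<epsilon> have K0: "0 < K"
    by (metis add_pos_pos divide_pos_pos less_le_trans of_nat_0_less_iff zero_less_one)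
  have "?V \<le> ?Q \<and> real ?Q \<le> real ?V + real ?N * real M * \<epsilon>"
  proof (cases "card C < K")
    case True
    then have "?Q = ?V" using I by (simp add: fast_query_def defs estimate_def)
    then show ?thesis using \<epsilon> by simp
  next
    case False
    then have full: "card C = K" and fin: "finite C" using I by auto
    then have "C \<noteq> {}" using K0 by auto
    define \<mu> where "\<mu> = Min (cnt \<sigma> ` C)"
    obtain m where m: "m \<in> C" "\<mu> = cnt \<sigma> m"
      unfolding \<mu>_def using Min_in [of "cnt \<sigma> ` C"] fin \<open>C \<noteq> {}\<close>
      by (metis finite_imageI image_iff image_is_empty)
    have Q: "?Q = (if x \<in> C then estimate s \<sigma> x else s - 1 + s * \<mu>)"
      using False by (simp add: fast_query_def defs estimate_def \<mu>_def)
    \<comment> \<open>For an untracked item both this bound and the next come from instantiating the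
      invariant at the minimiser \<open>m\<close>.\<close>
    have lower: "?V \<le> ?Q"
      using I m by (auto simp: Q)
    have "?Q \<le> ?V + (s - 1 + s * \<mu>)"
      using I m by (auto simp: Q)
    then have upper: "real ?Q \<le> real ?V + real (s - 1) + real (s * \<mu>)"
      by linarith
    \<comment> \<open>Averaging: each of the \<open>K\<close> tracked estimates is at least
      \<open>s * \<mu>\<close>.\<close>
    have "K * (s * \<mu>) = (\<Sum>y\<in>C. s * \<mu>)" using full by simp
    also have "\<dots> \<le> (\<Sum>y\<in>C. estimate s \<sigma> y)"
      by (rule sum_mono) (simp add: estimate_def \<mu>_def fin trans_le_add2)
    also have "\<dots> \<le> ?N * (M + (s - 1))" using I by blast
    finally have "real K * real (s * \<mu>) \<le> real ?N * (real M + real (s - 1))"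
      by (metis of_nat_add of_nat_le_iff of_nat_mult)
    \<comment> \<open>The step size is one more than the floor of
      \<open>M * \<phi> / 2\<close>.\<close>
    moreover have s1: "real (s - 1) \<le> real M * \<phi> / 2"
    proof -
      have "0 \<le> real M * \<phi> / 2" using \<phi> by simp
      then show ?thesis unfolding s_def step_size_def by linarith
    qed
    moreover have "real ?N * (real M + real (s - 1)) \<le> real ?N * (real M + real M * \<phi> / 2)"
      using s1 by (intro mult_left_mono) auto
    ultimately have "real K * real (s * \<mu>) \<le> real ?N * (real M + real M * \<phi> / 2)"
      by linarith
    \<comment> \<open>Full counters require at least \<open>K\<close> arrivals, so
      \<open>K \<le> length ps\<close>; this spreads the rounding error over the stream.\<close>
    moreover have "real K * real (s - 1) \<le> real ?N * (real M * \<phi> / 2)"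
      using I full s1 by (intro mult_mono) auto
    ultimately have "real K * (real (s - 1) + real (s * \<mu>)) \<le> real ?N * real M * (1 + \<phi>)"
      by (simp add: algebra_simps)
    \<comment> \<open>The choice of \<open>K\<close> enters here, as
      \<open>1 + \<phi> \<le> K * \<epsilon>\<close>.\<close>
    also have "\<dots> \<le> real ?N * real M * (real K * \<epsilon>)"
      using K \<epsilon> by (intro mult_left_mono) (auto simp: field_simps)
    finally have "real K * (real (s - 1) + real (s * \<mu>)) \<le> real K * (real ?N * real M * \<epsilon>)"
      by (simp add: mult_ac)
    then have "real (s - 1) + real (s * \<mu>) \<le> real ?N * real M * \<epsilon>"
      using K0 by simp
    with lower upper show ?thesis by linarith
  qed
  then show "?V \<le> ?Q" and "real ?Q \<le> real ?V + real ?N * real M * \<epsilon>" by blast+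
qed

theorem theorem3:
  fixes U :: "'a set" and M :: nat and \<epsilon> \<phi> \<theta> :: real
  assumes "\<phi> > 0" and "\<epsilon> > 0" and "M > 0"
  shows "solves_weighted_heavy_hitters U M \<theta> \<epsilon> (fast_heavy_hitters U M \<epsilon> \<phi> \<theta>)"
  unfolding solves_weighted_heavy_hitters_def
proof (intro allI impI conjI)
  fix ps :: "('a \<times> nat) list"
  assume "weighted_stream U M ps"
  then have w: "\<forall>p\<in>set ps. snd p \<le> M" by (auto simp: weighted_stream_def)
  have "0 \<le> real M * \<phi> / 2" using assms by simp
  then have s: "0 < step_size M \<phi>"
    unfolding step_size_def by linarith
  have "0 < (1 + \<phi>) / \<epsilon>" using assms by simp
  then have K: "0 < num_counters \<epsilon> \<phi>"
    unfolding num_counters_def by linarith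
  show "\<exists>H. fast_heavy_hitters U M \<epsilon> \<phi> \<theta> ps H"
    using fast_run_total [OF K w s] by (auto simp: fast_heavy_hitters_def)
  fix H
  assume "fast_heavy_hitters U M \<epsilon> \<phi> \<theta> ps H"
  then obtain \<sigma> where run: "fast_run M \<epsilon> \<phi> ps \<sigma>"
    and H: "H = {x \<in> U. real (fast_query M \<epsilon> \<phi> \<sigma> x) \<ge> real (length ps) * real M * \<theta>}"
    by (auto simp: fast_heavy_hitters_def)
  \<comment> \<open>The lower bound keeps every heavy item in \<open>H\<close>; the upper bound
    leaves a light item's estimate below the threshold.\<close>
  note bounds = fast_query_bounds [OF fast_run_invariant [OF run w s] assms(1,2)]
  show "heavy_hitters_solution U M \<theta> \<epsilon> ps H"
    unfolding heavy_hitters_solution_def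
  proof (intro ballI conjI impI)
    fix x assume "x \<in> U"
    assume "real (length ps) * real M * \<theta> < real (volume ps x)"
    with \<open>x \<in> U\<close> bounds(1) [of x] show "x \<in> H" by (simp add: H)
  next
    fix x
    assume "real (volume ps x) < real (length ps) * real M * (\<theta> - \<epsilon>)"
    with bounds(2) [of x] show "x \<notin> H" by (simp add: H algebra_simps)
  qed
qed

end
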